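(* There is no constant $c\in(0,1)$ such that every finite group $G$ with $sd^*(G)>c$ is an Iwasawa group.
   Context: For a finite group $G$, $L(G)$ denotes the lattice of all subgroups of $G$. The subgroup commutativity degree of $G$ is $$sd(G)=\frac{1}{|L(G)|^2}\,\left|\{(H,K)\in L(G)^2 \mid HK=KH\}\right|.$$ Define $sd^*(G)=\min\{sd(S)\mid S \text{ is a section of } G\}$, where a section of $G$ is a quotient $H/N$ with $N\trianglelefteq H\le G$. An Iwasawa group is a finite nilpotent group whose subgroup lattice is modular. *)

theory Defs
  imports "HOL-Algebra.Algebra" "HOL-Analysis.Analysis"
begin

definition subgroups :: "('a, 'b) monoid_scheme \<Rightarrow> 'a set set" where
  "subgroups G = {H. subgroup H G}"

definition sd :: "('a, 'b) monoid_scheme \<Rightarrow> real" where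
  "sd G = real (card {(H, K). H \<in> subgroups G \<and> K \<in> subgroups G \<and>
                               H <#>\<^bsub>G\<^esub> K = K <#>\<^bsub>G\<^esub> H})
          / (real (card (subgroups G)))^2"

definition sd_star :: "('a, 'b) monoid_scheme \<Rightarrow> real" where
  "sd_star G = Min {sd ((G\<lparr>carrier := H\<rparr>) Mod N) | H N.
                      subgroup H G \<and> N \<lhd> (G\<lparr>carrier := H\<rparr>)}"

fun lower_central :: "('a, 'b) monoid_scheme \<Rightarrow> nat \<Rightarrow> 'a set" where
  "lower_central G 0 = carrier G"
| "lower_central G (Suc n) = generate G
     (\<Union>x \<in> lower_central G n. \<Union>y \<in> carrier G.
        {x \<otimes>\<^bsub>G\<^esub> y \<otimes>\<^bsub>G\<^esub> inv\<^bsub>G\<^esub> x \<otimes>\<^bsub>G\<^esub> inv\<^bsub>G\<^esub> y})"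

definition nilpotent_group :: "('a, 'b) monoid_scheme \<Rightarrow> bool" where
  "nilpotent_group G \<longleftrightarrow> group G \<and> (\<exists>n. lower_central G n = {\<one>\<^bsub>G\<^esub>})"

definition modular_subgroup_lattice :: "('a, 'b) monoid_scheme \<Rightarrow> bool" where
  "modular_subgroup_lattice G \<longleftrightarrow>
     (\<forall>H K L. subgroup H G \<longrightarrow> subgroup K G \<longrightarrow> subgroup L G \<longrightarrow> H \<subseteq> L \<longrightarrow>
        generate G (H \<union> K) \<inter> L = generate G (H \<union> (K \<inter> L)))"

definition Iwasawa_group :: "('a, 'b) monoid_scheme \<Rightarrow> bool" where
  "Iwasawa_group G \<longleftrightarrow> group G \<and> finite (carrier G) \<and> nilpotent_group G
                        \<and> modular_subgroup_lattice G"

end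

theory Submission
  imports Defs "HOL-Number_Theory.Cong"
begin

unbundle bit_operations_syntax

text \<open>
  Let \<open>q\<close> be an odd prime and let \<open>V\<close> be a nontrivial elementary abelian 2-group on which the cyclic
  group of order \<open>q\<close> acts irreducibly and without nonzero fixed points; such a \<open>V\<close> is found inside
  the space of bit strings of length \<open>q\<close>, acted on by rotation. The semidirect product \<open>G\<close> is not
  nilpotent since \<open>[V, G] = V\<close>. By irreducibility the only section of \<open>G\<close> that is not abelian is \<open>G\<close>
  itself, so \<open>sd\<^sup>*(G) = sd(G)\<close>. Two subgroups of \<open>G\<close> can fail to permute only if one of them is a
  complement of \<open>V\<close>. There are at most \<open>|V|\<close> complements, whereas \<open>V\<close> alone has at least \<open>|V|\<^sup>2 / 16\<close>
  subgroups, so \<open>sd(G) \<ge> 1 - 32 / |V|\<close>. As \<open>|V| \<ge> q\<close>, this tends to 1.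
\<close>

section \<open>The subgroup commutativity degree\<close>

lemma finite_subgroups:
  assumes "finite (carrier G)"
  shows "finite (subgroups G)"
  by (rule finite_subset[of _ "Pow (carrier G)"])
    (use assms in \<open>auto simp: subgroups_def dest: subgroup.subset\<close>)

lemma (in group) card_subgroups_pos:
  assumes "finite (carrier G)"
  shows "0 < card (subgroups G)"
  using finite_subgroups[OF assms] subgroup_self by (auto simp: subgroups_def card_gt_0_iff)

text \<open>An isomorphism maps subgroups bijectively to subgroups and respects set products, so
  both counts in \<open>sd\<close> agree. This is needed because the elements of a quotient are
  cosets: even \<open>G Mod {\<one>}\<close> is only isomorphic to \<open>G\<close>.\<close>

lemma sd_iso:
  assumes "group G" "group H" "h \<in> iso G H"
  shows "sd G = sd H"
proof -
  interpret G: group G by fact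
  interpret H: group H by fact
  have hom: "h \<in> hom G H" and bij: "bij_betw h (carrier G) (carrier H)"
    using assms(3) by (auto simp: iso_def)
  then have inj: "inj_on h (carrier G)"
    by (simp add: bij_betw_def)
  interpret h: group_hom G H h
    using hom by unfold_locales
  define k where "k = inv_into (carrier G) h"
  have k: "k \<in> iso H G"
    unfolding k_def using G.iso_set_sym assms(3) by blast
  interpret k: group_hom H G k
    using k by unfold_locales (auto simp: iso_def)
  have sub: "A \<subseteq> carrier G" if "A \<in> subgroups G" for A
    using that by (auto simp: subgroups_def dest: subgroup.subset)
  have bij_sub: "bij_betw (image h) (subgroups G) (subgroups H)"
    unfolding bij_betw_def
  proof
    show "inj_on (image h) (subgroups G)"
      by (rule inj_onI) (simp add: inj_on_image_eq_iff[OF inj] sub)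
    show "image h ` subgroups G = subgroups H"
    proof
      show "image h ` subgroups G \<subseteq> subgroups H"
        by (auto simp: subgroups_def h.subgroup_img_is_subgroup)
      show "subgroups H \<subseteq> image h ` subgroups G"
      proof
        fix B assume B: "B \<in> subgroups H"
        then have "h ` k ` B = B"
          unfolding k_def
          by (intro image_inv_into_cancel) (use bij in \<open>auto simp: subgroups_def bij_betw_def dest: subgroup.subset\<close>)
        moreover have "k ` B \<in> subgroups G"
          using B by (auto simp: subgroups_def k.subgroup_img_is_subgroup)
        ultimately show "B \<in> image h ` subgroups G"
          by (metis imageI)
      qed
    qed
  qed
  have permute: "h ` A <#>\<^bsub>H\<^esub> h ` B = h ` B <#>\<^bsub>H\<^esub> h ` A \<longleftrightarrow> A <#>\<^bsub>G\<^esub> B = B <#>\<^bsub>G\<^esub> A"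
    if "A \<in> subgroups G" "B \<in> subgroups G" for A B
  proof -
    have "A <#>\<^bsub>G\<^esub> B \<subseteq> carrier G" "B <#>\<^bsub>G\<^esub> A \<subseteq> carrier G"
      using that sub by (simp_all add: G.setmult_subset_G)
    then show ?thesis
      using set_mult_hom[OF hom] sub that inj_on_image_eq_iff[OF inj] by metis
  qed
  have "bij_betw (map_prod (image h) (image h))
     {(A, B). A \<in> subgroups G \<and> B \<in> subgroups G \<and> A <#>\<^bsub>G\<^esub> B = B <#>\<^bsub>G\<^esub> A}
     {(A, B). A \<in> subgroups H \<and> B \<in> subgroups H \<and> A <#>\<^bsub>H\<^esub> B = B <#>\<^bsub>H\<^esub> A}"
    (is "bij_betw ?f ?P ?Q")
    unfolding bij_betw_def
  proof
    show "inj_on ?f ?P"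
      by (rule inj_on_subset[OF map_prod_inj_on[OF bij_betw_imp_inj_on[OF bij_sub] bij_betw_imp_inj_on[OF bij_sub]]])
        blast
    show "?f ` ?P = ?Q"
    proof
      show "?f ` ?P \<subseteq> ?Q"
      proof (rule image_subsetI)
        fix p assume "p \<in> ?P"
        then obtain A B where AB: "p = (A, B)" "A \<in> subgroups G" "B \<in> subgroups G"
          "A <#>\<^bsub>G\<^esub> B = B <#>\<^bsub>G\<^esub> A"
          by blast
        then show "?f p \<in> ?Q"
          using permute[of A B] bij_betwE[OF bij_sub] by simp
      qed
      show "?Q \<subseteq> ?f ` ?P"
      proof
        fix p assume "p \<in> ?Q"
        then obtain A B where *: "p = (A, B)" "A \<in> subgroups H" "B \<in> subgroups H"
          "A <#>\<^bsub>H\<^esub> B = B <#>\<^bsub>H\<^esub> A"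
          by blast
        have surj: "\<exists>C'\<in>subgroups G. C = h ` C'" if "C \<in> subgroups H" for C
          using that unfolding bij_betw_imp_surj_on[OF bij_sub, symmetric] by (rule imageE) (rule bexI)
        obtain A' where A': "A' \<in> subgroups G" "A = h ` A'"
          using surj[OF *(2)] by (rule bexE)
        obtain B' where B': "B' \<in> subgroups G" "B = h ` B'"
          using surj[OF *(3)] by (rule bexE)
        have "(A', B') \<in> ?P"
          using A' B' * permute[of A' B'] by simp
        then show "p \<in> ?f ` ?P"
          by (rule rev_image_eqI) (simp add: * A' B')
      qed
    qed
  qed
  from bij_betw_same_card[OF this] bij_betw_same_card[OF bij_sub] show ?thesis
    by (simp add: sd_def)
qed

lemma set_mult_commute:
  assumes "\<And>a b. a \<in> A \<Longrightarrow> b \<in> B \<Longrightarrow> a \<otimes>\<^bsub>G\<^esub> b = b \<otimes>\<^bsub>G\<^esub> a"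
  shows "A <#>\<^bsub>G\<^esub> B = B <#>\<^bsub>G\<^esub> A"
proof -
  have "(\<Union>a\<in>A. \<Union>b\<in>B. {a \<otimes>\<^bsub>G\<^esub> b}) = (\<Union>a\<in>A. \<Union>b\<in>B. {b \<otimes>\<^bsub>G\<^esub> a})"
    by (intro SUP_cong refl) (metis assms)
  also have "\<dots> = (\<Union>b\<in>B. \<Union>a\<in>A. {b \<otimes>\<^bsub>G\<^esub> a})"
    by (rule SUP_commute)
  finally show ?thesis
    by (simp add: set_mult_def)
qed

lemma sd_eq_1_of_commute:
  assumes "group G" "finite (carrier G)"
    and comm: "\<And>x y. x \<in> carrier G \<Longrightarrow> y \<in> carrier G \<Longrightarrow> x \<otimes>\<^bsub>G\<^esub> y = y \<otimes>\<^bsub>G\<^esub> x"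
  shows "sd G = 1"
proof -
  have "A <#>\<^bsub>G\<^esub> B = B <#>\<^bsub>G\<^esub> A" if "A \<in> subgroups G" "B \<in> subgroups G" for A B
  proof -
    have "A \<subseteq> carrier G" "B \<subseteq> carrier G"
      using that by (auto simp: subgroups_def dest: subgroup.subset)
    then show ?thesis
      using comm by (intro set_mult_commute) (simp add: subset_iff)
  qed
  then have "{(A, B). A \<in> subgroups G \<and> B \<in> subgroups G \<and> A <#>\<^bsub>G\<^esub> B = B <#>\<^bsub>G\<^esub> A}
      = subgroups G \<times> subgroups G"
    by auto
  then show ?thesis
    using group.card_subgroups_pos[OF assms(1,2)]
    by (simp add: sd_def card_cartesian_product power2_eq_square)
qed

text \<open>The quotient is abelian once \<open>N\<close> contains all commutators. The hypothesis
  is stated in \<open>G\<close>, so sections can be handled without computing with cosets.\<close>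

lemma sd_Mod_eq_1:
  assumes "group G" "finite (carrier G)" and N: "N \<lhd> G"
    and comm: "\<And>x y. x \<in> carrier G \<Longrightarrow> y \<in> carrier G \<Longrightarrow> x \<otimes>\<^bsub>G\<^esub> y \<otimes>\<^bsub>G\<^esub> inv\<^bsub>G\<^esub> x \<otimes>\<^bsub>G\<^esub> inv\<^bsub>G\<^esub> y \<in> N"
  shows "sd (G Mod N) = 1"
proof (rule sd_eq_1_of_commute)
  interpret N: normal N G by fact
  show "group (G Mod N)"
    by (rule N.factorgroup_is_group)
  show "finite (carrier (G Mod N))"
    using assms(2) by (simp add: carrier_FactGroup)
  fix A B assume "A \<in> carrier (G Mod N)" "B \<in> carrier (G Mod N)"
  then obtain x y where xy: "x \<in> carrier G" "y \<in> carrier G" "A = N #>\<^bsub>G\<^esub> x" "B = N #>\<^bsub>G\<^esub> y"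
    by (auto simp: carrier_FactGroup)
  have "x \<otimes>\<^bsub>G\<^esub> y = (x \<otimes>\<^bsub>G\<^esub> y \<otimes>\<^bsub>G\<^esub> inv\<^bsub>G\<^esub> x \<otimes>\<^bsub>G\<^esub> inv\<^bsub>G\<^esub> y) \<otimes>\<^bsub>G\<^esub> (y \<otimes>\<^bsub>G\<^esub> x)"
    using xy by (simp add: N.m_assoc) (simp add: N.m_assoc[symmetric])
  then have "x \<otimes>\<^bsub>G\<^esub> y \<in> N #>\<^bsub>G\<^esub> (y \<otimes>\<^bsub>G\<^esub> x)"
    using comm[OF xy(1,2)] by (auto simp: r_coset_def)
  then have "N #>\<^bsub>G\<^esub> (x \<otimes>\<^bsub>G\<^esub> y) = N #>\<^bsub>G\<^esub> (y \<otimes>\<^bsub>G\<^esub> x)"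
    using N.repr_independence[OF _ _ N.subgroup_axioms] xy by force
  then show "A \<otimes>\<^bsub>G Mod N\<^esub> B = B \<otimes>\<^bsub>G Mod N\<^esub> A"
    using xy by (simp add: N.rcos_sum)
qed

lemma sd_Mod_one:
  assumes "group G"
  shows "sd (G Mod {\<one>\<^bsub>G\<^esub>}) = sd G"
proof -
  interpret group G by fact
  have "{\<one>\<^bsub>G\<^esub>} \<lhd> G"
    by (simp add: normal_inv_iff triv_subgroup)
  then show ?thesis
    using sd_iso[OF normal.factorgroup_is_group assms trivial_factor_iso] by blast
qed

section \<open>Groups with a maximal, minimal normal elementary abelian 2-subgroup\<close>

text \<open>The features of the semidirect product that the estimate uses: \<open>G\<close> modulo
  \<open>V\<close> is abelian and has no intermediate subgroup, and \<open>V\<close> is an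
  irreducible module on which \<open>G\<close> acts nontrivially. All proper subgroups and all
  proper quotients then turn out to be abelian.\<close>

locale minimal_nonnilpotent = group G for G (structure) +
  fixes V
  assumes finite_carrier: "finite (carrier G)"
    and V_subgroup: "subgroup V G"
    and V_comm: "\<And>x y. x \<in> V \<Longrightarrow> y \<in> V \<Longrightarrow> x \<otimes> y = y \<otimes> x"
    and V_square: "\<And>x. x \<in> V \<Longrightarrow> x \<otimes> x = \<one>"
    and commutator_in_V: "\<And>x y. x \<in> carrier G \<Longrightarrow> y \<in> carrier G \<Longrightarrow> x \<otimes> y \<otimes> inv x \<otimes> inv y \<in> V"
    and V_maximal: "\<And>H. subgroup H G \<Longrightarrow> V \<subseteq> H \<Longrightarrow> H = V \<or> H = carrier G"
    and V_minimal: "\<And>W. W \<lhd> G \<Longrightarrow> W \<subseteq> V \<Longrightarrow> W = {\<one>} \<or> W = V"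
    and V_noncentral: "\<exists>v\<in>V. \<exists>g\<in>carrier G. v \<otimes> g \<noteq> g \<otimes> v"
begin

section \<open>Position of subgroups relative to \<open>V\<close>\<close>

lemma V_carrier: "x \<in> V \<Longrightarrow> x \<in> carrier G"
  using subgroup.mem_carrier[OF V_subgroup] .

lemma V_normal: "V \<lhd> G"
  unfolding normal_inv_iff
proof (intro conjI ballI V_subgroup)
  fix x h assume x: "x \<in> carrier G" "h \<in> V"
  have "x \<otimes> h \<otimes> inv x = (x \<otimes> h \<otimes> inv x \<otimes> inv h) \<otimes> h"
    using x V_carrier by (simp add: m_assoc)
  then show "x \<otimes> h \<otimes> inv x \<in> V"
    using commutator_in_V x V_carrier subgroup.m_closed[OF V_subgroup] by metis
qed

text \<open>If \<open>V\<close> were all of \<open>G\<close>, then \<open>G\<close> would be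
  abelian, against \<open>V_noncentral\<close>.\<close>

lemma V_proper: "V \<noteq> carrier G"
  using V_noncentral V_comm by blast

text \<open>As \<open>V\<close> is normal, \<open>V <#> H\<close> is a subgroup; it contains
  \<open>V\<close> properly, so maximality applies.\<close>

lemma V_set_mult_eq_carrier:
  assumes "subgroup H G" "\<not> H \<subseteq> V"
  shows "V <#> H = carrier G"
proof -
  have sub: "subgroup (V <#> H) G"
    by (rule mult_norm_subgroup[OF V_normal assms(1)])
  have "V \<subseteq> V <#> H"
    using subgroup.one_closed[OF assms(1)] V_carrier r_one by (force simp: set_mult_def)
  moreover have "H \<subseteq> V <#> H"
    using subgroup.one_closed[OF V_subgroup] subgroup.mem_carrier[OF assms(1)] l_one
    by (force simp: set_mult_def)
  ultimately show ?thesis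
    using V_maximal[OF sub] assms(2) by blast
qed

text \<open>The intersection is normalized by \<open>H\<close>, since \<open>V\<close> is normal,
  and centralized by the abelian group \<open>V\<close>. Since \<open>V\<close> and \<open>H\<close>
  together give \<open>G\<close>, it is normal in \<open>G\<close>, and minimality leaves two cases;
  if \<open>H\<close> contains \<open>V\<close>, maximality yields
  \<open>H = carrier G\<close>.\<close>

lemma subgroup_Int_V:
  assumes H: "subgroup H G" "\<not> H \<subseteq> V"
  shows "H \<inter> V = {\<one>} \<or> H = carrier G"
proof -
  have "H \<inter> V \<lhd> G"
    unfolding normal_inv_iff
  proof (intro conjI ballI)
    show "subgroup (H \<inter> V) G"
      using H V_subgroup by (rule_tac subgroups_Inter_pair)
    fix x w assume x: "x \<in> carrier G" and w: "w \<in> H \<inter> V"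
    obtain v h where vh: "v \<in> V" "h \<in> H" "x = v \<otimes> h"
      using x V_set_mult_eq_carrier[OF H] unfolding set_mult_def by blast
    have hc: "h \<in> carrier G" and wc: "w \<in> carrier G" and vc: "v \<in> carrier G"
      using vh w V_carrier subgroup.mem_carrier[OF H(1)] by auto
    define u where "u = h \<otimes> w \<otimes> inv h"
    have uV: "u \<in> V"
      using V_normal hc w by (auto simp: u_def normal_inv_iff)
    have uH: "u \<in> H"
      using w vh H(1) by (auto simp: u_def subgroup.m_closed subgroup.m_inv_closed)
    have uc: "u \<in> carrier G"
      using uV V_carrier by blast
    have "x \<otimes> w \<otimes> inv x = v \<otimes> u \<otimes> inv v"
      using hc wc vc by (simp add: vh u_def inv_mult_group m_assoc)
    also have "\<dots> = u \<otimes> v \<otimes> inv v"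
      using V_comm[OF vh(1) uV] by simp
    also have "\<dots> = u"
      using uc vc by (simp add: m_assoc)
    finally show "x \<otimes> w \<otimes> inv x \<in> H \<inter> V"
      using uV uH by simp
  qed
  then consider "H \<inter> V = {\<one>}" | "H \<inter> V = V"
    using V_minimal by blast
  then show ?thesis
    by cases (use V_maximal[OF H(1)] H(2) in blast)+
qed

text \<open>Commutators of \<open>N\<close> with \<open>V\<close> lie in
  \<open>N \<inter> V\<close>, so \<open>N\<close> centralizes \<open>V\<close>. If \<open>N\<close>
  were nontrivial, the centralizer \<open>C\<close> of \<open>V\<close> would properly contain
  \<open>V\<close>, hence be all of \<open>G\<close>, contradicting
  \<open>V_noncentral\<close>.\<close>

lemma normal_Int_V_trivial:
  assumes N: "N \<lhd> G" "N \<inter> V = {\<one>}"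
  shows "N = {\<one>}"
proof (rule ccontr)
  assume "N \<noteq> {\<one>}"
  have Nsub: "subgroup N G"
    using N(1) by (rule normal_imp_subgroup)
  then obtain n where n: "n \<in> N" "n \<notin> V"
    using \<open>N \<noteq> {\<one>}\<close> N(2) subgroup.one_closed[OF Nsub] by blast
  have nc: "n \<in> carrier G"
    using n subgroup.mem_carrier[OF Nsub] by blast
  have comm: "n \<otimes> v = v \<otimes> n" if v: "v \<in> V" for v
  proof -
    have vc: "v \<in> carrier G"
      using v V_carrier by blast
    have "v \<otimes> inv n \<otimes> inv v \<in> N"
      using N(1) vc subgroup.m_inv_closed[OF Nsub n(1)] by (simp add: normal_inv_iff)
    then have "n \<otimes> (v \<otimes> inv n \<otimes> inv v) \<in> N"
      using subgroup.m_closed[OF Nsub n(1)] by blast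
    then have "n \<otimes> v \<otimes> inv n \<otimes> inv v \<in> N"
      using vc nc by (simp add: m_assoc)
    then have "n \<otimes> v \<otimes> inv n \<otimes> inv v = \<one>"
      using N(2) commutator_in_V[OF nc vc] by blast
    then have "n \<otimes> v \<otimes> inv (v \<otimes> n) = \<one>"
      using vc nc by (simp add: m_assoc inv_mult_group)
    then show ?thesis
      using vc nc by (metis inv_equality inv_inv inv_closed m_closed)
  qed
  define C where "C = {g \<in> carrier G. \<forall>v\<in>V. g \<otimes> v = v \<otimes> g}"
  have "subgroup C G"
  proof (rule subgroupI)
    show "C \<subseteq> carrier G" "C \<noteq> {}"
      using nc comm by (auto simp: C_def)
    fix a assume a: "a \<in> C"
    show "inv a \<in> C"
      unfolding C_def
    proof (intro CollectI conjI ballI)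
      show ac: "inv a \<in> carrier G" using a by (simp add: C_def)
      fix v assume v: "v \<in> V"
      then have c: "a \<in> carrier G" "v \<in> carrier G" and "v \<otimes> a = a \<otimes> v"
        using a V_carrier by (auto simp: C_def)
      then have "inv a \<otimes> (v \<otimes> a) \<otimes> inv a = v \<otimes> inv a"
        by (simp add: m_assoc[symmetric])
      then show "inv a \<otimes> v = v \<otimes> inv a"
        using c by (simp add: m_assoc)
    qed
    fix b assume b: "b \<in> C"
    show "a \<otimes> b \<in> C"
      using a b V_carrier by (auto simp: C_def) (metis m_assoc)
  qed
  moreover have "V \<subseteq> C"
    using V_comm V_carrier by (auto simp: C_def)
  moreover have "n \<in> C"
    using nc comm by (simp add: C_def)
  ultimately have "C = carrier G"
    using V_maximal n by blast
  moreover obtain v g where "v \<in> V" "g \<in> carrier G" "v \<otimes> g \<noteq> g \<otimes> v"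
    using V_noncentral by blast
  ultimately show False
    by (metis (mono_tags, lifting) C_def mem_Collect_eq)
qed

text \<open>The subgroup \<open>W\<close> generated by the commutators of \<open>V\<close> with
  \<open>G\<close> is normal, nontrivial and inside \<open>V\<close>, hence equal to
  \<open>V\<close>. By induction \<open>V\<close> stays inside every term of the lower central
  series.\<close>

lemma not_nilpotent: "\<not> nilpotent_group G"
proof -
  define S where "S = (\<Union>x\<in>V. \<Union>y\<in>carrier G. {x \<otimes> y \<otimes> inv x \<otimes> inv y})"
  have SV: "S \<subseteq> V"
    using commutator_in_V V_carrier by (auto simp: S_def)
  have Sc: "S \<subseteq> carrier G"
    using SV V_carrier by blast
  define W where "W = generate G S"
  have Wsub: "subgroup W G"
    unfolding W_def by (rule generate_is_subgroup[OF Sc])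
  have WV: "W \<subseteq> V"
    unfolding W_def by (rule generate_subgroup_incl[OF SV V_subgroup])
  have "W \<lhd> G"
    unfolding normal_inv_iff
  proof (intro conjI ballI Wsub)
    fix x w assume x: "x \<in> carrier G" and w: "w \<in> W"
    then have wc: "w \<in> carrier G" using WV V_carrier by blast
    have "w \<otimes> x \<otimes> inv w \<otimes> inv x \<in> W"
      unfolding W_def by (rule generate.incl) (use x w WV in \<open>auto simp: S_def\<close>)
    \<comment> \<open>The conjugate of \<open>w\<close> by \<open>x\<close> is the inverse of the
      commutator of \<open>w\<close> and \<open>x\<close>, times \<open>w\<close>.\<close>
    then have "inv (w \<otimes> x \<otimes> inv w \<otimes> inv x) \<otimes> w \<in> W"
      using w Wsub by (simp add: subgroup.m_closed subgroup.m_inv_closed)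
    then show "x \<otimes> w \<otimes> inv x \<in> W"
      using x wc by (simp add: inv_mult_group m_assoc)
  qed
  moreover have "W \<noteq> {\<one>}"
  proof
    assume W1: "W = {\<one>}"
    obtain v g where vg: "v \<in> V" "g \<in> carrier G" "v \<otimes> g \<noteq> g \<otimes> v"
      using V_noncentral by blast
    then have "v \<otimes> g \<otimes> inv v \<otimes> inv g \<in> W"
      unfolding W_def by (intro generate.incl) (auto simp: S_def)
    then have "v \<otimes> g \<otimes> inv (g \<otimes> v) = \<one>"
      using vg V_carrier W1 by (simp add: m_assoc inv_mult_group)
    then show False
      using vg V_carrier by (metis inv_equality inv_inv inv_closed m_closed)
  qed
  ultimately have WV: "W = V"
    using V_minimal WV by blast
  have "V \<subseteq> lower_central G n" for n
  proof (induction n)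
    case 0
    then show ?case using V_carrier by auto
  next
    case (Suc n)
    have "S \<subseteq> (\<Union>x\<in>lower_central G n. \<Union>y\<in>carrier G. {x \<otimes> y \<otimes> inv x \<otimes> inv y})"
      using Suc by (auto simp: S_def)
    then have "W \<subseteq> lower_central G (Suc n)"
      unfolding W_def by (simp add: mono_generate)
    then show ?case using WV by simp
  qed
  moreover have "\<not> V \<subseteq> {\<one>}"
    using V_noncentral by auto
  ultimately show ?thesis
    by (auto simp: nilpotent_group_def)
qed

section \<open>Counting complements of \<open>V\<close> and subgroups of \<open>V\<close>\<close>

text \<open>By \<open>V_set_mult_eq_carrier\<close> and \<open>subgroup_Int_V\<close> these
  subgroups are complements of \<open>V\<close> in the usual sense. In this form it is immediate
  that any other subgroup lies in \<open>V\<close> or is the whole group.\<close>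

definition complements :: "'a set set" where
  "complements = {H \<in> subgroups G. \<not> H \<subseteq> V \<and> H \<noteq> carrier G}"

text \<open>Fix \<open>z\<close> outside \<open>V\<close>. Every complement \<open>H\<close> meets
  the coset of \<open>z\<close>, so it contains \<open>inv v \<otimes> z\<close> for some
  \<open>v\<close> in \<open>V\<close>. That element determines \<open>H\<close>, so choosing such a
  \<open>v\<close> for each \<open>H\<close> is injective.\<close>

lemma card_complements_le: "card complements \<le> card V"
proof -
  obtain z where z: "z \<in> carrier G" "z \<notin> V"
    using V_proper V_carrier by blast
  have "\<exists>v\<in>V. inv v \<otimes> z \<in> H" if "H \<in> complements" for H
  proof -
    have H: "subgroup H G" "\<not> H \<subseteq> V"
      using that by (auto simp: complements_def subgroups_def)
    obtain v h where vh: "v \<in> V" "h \<in> H" "z = v \<otimes> h"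
      using z V_set_mult_eq_carrier[OF H] unfolding set_mult_def by blast
    then have "inv v \<otimes> z = h"
      using V_carrier subgroup.mem_carrier[OF H(1)] by (simp add: m_assoc[symmetric])
    then show ?thesis using vh by blast
  qed
  then obtain f where f: "\<And>H. H \<in> complements \<Longrightarrow> f H \<in> V \<and> inv (f H) \<otimes> z \<in> H"
    by metis
  \<comment> \<open>A complement \<open>H\<close> is generated by any of its elements \<open>h\<close> outside \<open>V\<close>, because \<open>V\<langle>h\<rangle>\<close> is all of \<open>G\<close>.\<close>
  have gen: "H = generate G {inv (f H) \<otimes> z}" if HC: "H \<in> complements" for H
  proof -
    define h where "h = inv (f H) \<otimes> z"
    have H: "subgroup H G" "\<not> H \<subseteq> V" "H \<noteq> carrier G"
      using HC by (auto simp: complements_def subgroups_def)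
    have fV: "f H \<in> V" and hH: "h \<in> H"
      using f[OF HC] by (auto simp: h_def)
    have hc: "h \<in> carrier G"
      using hH subgroup.mem_carrier[OF H(1)] by blast
    have "z = f H \<otimes> h"
      using fV V_carrier z by (simp add: h_def m_assoc[symmetric])
    then have hV: "h \<notin> V"
      using z fV subgroup.m_closed[OF V_subgroup] by metis
    have gsub: "subgroup (generate G {h}) G"
      using hc by (intro generate_is_subgroup) auto
    have gH: "generate G {h} \<subseteq> H"
      using hH H(1) by (intro generate_subgroup_incl) auto
    have "\<not> generate G {h} \<subseteq> V"
      using hV generate.incl[of h "{h}" G] by auto
    then have all: "V <#> generate G {h} = carrier G"
      using V_set_mult_eq_carrier[OF gsub] by blast
    have "H \<subseteq> generate G {h}"
    proof
      fix x assume x: "x \<in> H"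
      then have "x \<in> V <#> generate G {h}"
        using all subgroup.mem_carrier[OF H(1)] by blast
      then obtain v g where vg: "v \<in> V" "g \<in> generate G {h}" "x = v \<otimes> g"
        by (auto simp: set_mult_def)
      have gH': "g \<in> H" and gc: "g \<in> carrier G" and vc: "v \<in> carrier G"
        using vg gH subgroup.mem_carrier[OF H(1)] V_carrier by blast+
      \<comment> \<open>The \<open>V\<close>-component \<open>v\<close> of an element of
        \<open>H\<close> lies in \<open>H\<close> as well, so it is trivial.\<close>
      have "v = x \<otimes> inv g"
        using vg gc vc by (simp add: m_assoc)
      then have "v \<in> H"
        using x gH' H(1) by (simp add: subgroup.m_closed subgroup.m_inv_closed)
      then have "v = \<one>"
        using vg subgroup_Int_V[OF H(1,2)] H(3) by blast
      then show "x \<in> generate G {h}"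
        using vg gc by simp
    qed
    then show ?thesis using gH by (auto simp: h_def)
  qed
  have "inj_on f complements"
    by (rule inj_onI) (metis gen)
  moreover have "f ` complements \<subseteq> V"
    using f by blast
  moreover have "finite V"
    using finite_subset[OF _ finite_carrier] V_carrier by blast
  ultimately show ?thesis
    by (rule card_inj_on_le)
qed

text \<open>Each pair of elements of \<open>V\<close> lies in a subgroup
  \<open>{\<one>, a, b, a \<otimes> b}\<close> of order at most 4. The squares of these subgroups
  cover \<open>V \<times> V\<close>, and each square has at most 16 elements.\<close>

lemma card_subgroups_ge: "(card V)\<^sup>2 \<le> 16 * card {H \<in> subgroups G. H \<subseteq> V}"
proof -
  define F where "F = (\<lambda>(a, b). {\<one>, a, b, a \<otimes> b})"
  define A where "A = {H \<in> subgroups G. H \<subseteq> V}"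
  have finV: "finite V"
    using finite_subset[OF _ finite_carrier] V_carrier by blast
  have finA: "finite A"
    using finite_subgroups[OF finite_carrier] by (simp add: A_def)
  have FA: "F p \<in> A" if p: "p \<in> V \<times> V" for p
  proof -
    obtain a b where ab: "p = (a, b)" "a \<in> V" "b \<in> V"
      using p by auto
    have c: "a \<in> carrier G" "b \<in> carrier G"
      using ab V_carrier by auto
    have inv: "inv x = x" if "x \<in> V" for x
      using that V_square V_carrier by (simp add: inv_equality)
    have e: "b \<otimes> a = a \<otimes> b" "a \<otimes> a = \<one>" "b \<otimes> b = \<one>"
      using ab V_comm V_square by auto
    \<comment> \<open>With associativity, these rules reduce any product of two elements of
      \<open>F p\<close> to one of its four listed elements.\<close>
    have e2: "a \<otimes> (a \<otimes> x) = x" "b \<otimes> (b \<otimes> x) = x" "b \<otimes> (a \<otimes> x) = a \<otimes> (b \<otimes> x)" if "x \<in> carrier G" for x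
      using c e that by (simp_all add: m_assoc[symmetric])
    have sub: "F p \<subseteq> V"
      using ab V_subgroup by (auto simp: F_def subgroup.one_closed subgroup.m_closed)
    have "subgroup (F p) G"
    proof (rule subgroupI)
      show "F p \<subseteq> carrier G" using sub V_carrier by blast
      show "F p \<noteq> {}" by (simp add: F_def ab)
      show "inv x \<in> F p" if "x \<in> F p" for x
        using that sub inv by (metis subsetD)
      show "x \<otimes> y \<in> F p" if "x \<in> F p" "y \<in> F p" for x y
        using that c e e2 by (auto simp: F_def ab m_assoc)
    qed
    then show ?thesis using sub by (simp add: A_def subgroups_def)
  qed
  have "V \<times> V \<subseteq> (\<Union>H\<in>F ` (V \<times> V). H \<times> H)"
    by (auto simp: F_def)
  moreover have fin: "finite (F ` (V \<times> V))"
    using finV by blast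
  moreover have cardF: "finite H \<and> card H \<le> 4" if "H \<in> F ` (V \<times> V)" for H
    using that by (auto simp: F_def card_insert_if)
  ultimately have "card (V \<times> V) \<le> card (\<Union>H\<in>F ` (V \<times> V). H \<times> H)"
    by (intro card_mono finite_UN_I finite_cartesian_product) blast+
  also have "\<dots> \<le> (\<Sum>H\<in>F ` (V \<times> V). card (H \<times> H))"
    by (rule card_UN_le[OF fin])
  also have "\<dots> \<le> (\<Sum>H\<in>F ` (V \<times> V). 16)"
  proof (rule sum_mono)
    fix H assume "H \<in> F ` (V \<times> V)"
    then have "card H * card H \<le> 4 * 4"
      using cardF by (intro mult_le_mono) auto
    then show "card (H \<times> H) \<le> 16" by (simp add: card_cartesian_product)
  qed
  also have "\<dots> \<le> 16 * card A"
    using card_mono[OF finA, of "F ` (V \<times> V)"] FA by auto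
  finally show ?thesis
    by (simp add: card_cartesian_product power2_eq_square A_def)
qed

text \<open>Two subgroups that are not complements always permute. If \<open>y\<close> is the
  proportion of complements, then \<open>sd G\<close> is at least the square of
  \<open>1 - y\<close>, hence at least \<open>1 - 2 * y\<close>; the two counts bound
  \<open>y\<close> by 16 divided by the order of \<open>V\<close>.\<close>

lemma sd_ge: "1 - 32 / real (card V) \<le> sd G"
proof -
  define A where "A = subgroups G - complements"
  define m where "m = real (card V)"
  define a where "a = real (card A)"
  define L where "L = real (card (subgroups G))"
  have fin: "finite (subgroups G)"
    by (rule finite_subgroups[OF finite_carrier])
  have finV: "finite V"
    using finite_subset[OF _ finite_carrier] V_carrier by blast
  have m: "m > 0"
    using finV V_noncentral by (auto simp: m_def card_gt_0_iff)
  have L: "L > 0"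
    using card_subgroups_pos[OF finite_carrier] by (simp add: L_def)
  have sub: "complements \<subseteq> subgroups G"
    by (auto simp: complements_def)
  then have aL: "a = L - real (card complements)"
    using fin card_mono[OF fin sub] finite_subset[OF sub fin]
    by (simp add: a_def L_def A_def card_Diff_subset of_nat_diff)
  have "m\<^sup>2 \<le> 16 * real (card {H \<in> subgroups G. H \<subseteq> V})"
    using of_nat_mono[OF card_subgroups_ge, where 'a = real] by (simp add: m_def)
  also have "\<dots> \<le> 16 * L"
    using card_mono[OF fin, of "{H \<in> subgroups G. H \<subseteq> V}"] by (auto simp: L_def)
  finally have mL: "m\<^sup>2 \<le> 16 * L" .
  define y where "y = real (card complements) / L"
  have "y \<le> m / L"
    using card_complements_le L by (simp add: y_def m_def divide_right_mono)
  also have "\<dots> \<le> 16 / m"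
    using mL m L by (simp add: field_simps power2_eq_square)
  finally have y: "y \<le> 16 / m" .
  have perm: "A \<times> A \<subseteq> {(H, K). H \<in> subgroups G \<and> K \<in> subgroups G \<and> H <#> K = K <#> H}"
  proof clarify
    fix H K assume HK: "H \<in> A" "K \<in> A"
    \<comment> \<open>The whole group is the only subgroup outside both \<open>V\<close> and
      \<open>complements\<close>; being normal, it permutes with every subgroup.\<close>
    have car: "carrier G <#> B = B <#> carrier G" if "subgroup B G" for B
      by (rule commut_normal[OF that, symmetric]) (simp add: normal_inv_iff subgroup_self)
    have "H <#> K = K <#> H"
    proof (cases "H \<subseteq> V \<and> K \<subseteq> V")
      case True
      then show ?thesis
        using V_comm by (intro set_mult_commute) (simp add: subset_iff)
    next
      case False
      then show ?thesis
        using HK car by (auto simp: A_def complements_def subgroups_def)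
    qed
    then show "H \<in> subgroups G \<and> K \<in> subgroups G \<and> H <#> K = K <#> H"
      using HK by (simp add: A_def)
  qed
  have "card A * card A \<le> card {(H, K). H \<in> subgroups G \<and> K \<in> subgroups G \<and> H <#> K = K <#> H}"
    unfolding card_cartesian_product[symmetric]
    by (rule card_mono[OF finite_subset[OF _ finite_cartesian_product[OF fin fin]] perm]) auto
  then have "a * a \<le> real (card {(H, K). H \<in> subgroups G \<and> K \<in> subgroups G \<and> H <#> K = K <#> H})"
    unfolding a_def of_nat_mult[symmetric] of_nat_le_iff .
  then have sd: "a * a / L\<^sup>2 \<le> sd G"
    by (simp add: sd_def L_def divide_right_mono)
  have "a / L = 1 - y"
    using L by (simp add: aL y_def field_simps)
  then have "a * a / L\<^sup>2 = (1 - y)\<^sup>2"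
    by (metis power2_eq_square times_divide_times_eq)
  also have "\<dots> = 1 - 2 * y + y\<^sup>2"
    by (simp add: power2_eq_square algebra_simps)
  finally have "1 - 2 * y \<le> sd G"
    using sd zero_le_power2[of y] by linarith
  then show ?thesis
    using y by (simp add: m_def)
qed

section \<open>Sections of the group\<close>

text \<open>Only the section with \<open>H = carrier G\<close> and \<open>N = {\<one>}\<close> needs
  \<open>sd_ge\<close>. Otherwise the commutators of \<open>H\<close> lie in \<open>N\<close>: they
  are trivial if \<open>H\<close> is inside \<open>V\<close> or meets it trivially, and a nontrivial
  normal subgroup of \<open>G\<close> contains \<open>V\<close>.\<close>

lemma sd_section_ge:
  assumes H: "subgroup H G" and N: "N \<lhd> G\<lparr>carrier := H\<rparr>"
  shows "1 - 32 / real (card V) \<le> sd ((G\<lparr>carrier := H\<rparr>) Mod N)"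
proof -
  have gH: "group (G\<lparr>carrier := H\<rparr>)"
    using H by (rule subgroup_imp_group)
  have finH: "finite (carrier (G\<lparr>carrier := H\<rparr>))"
    using finite_subset[OF subgroup.subset[OF H] finite_carrier] by simp
  have one: "\<one> \<in> N"
    using subgroup.one_closed[OF normal_imp_subgroup[OF N]] by simp
  have le1: "1 - 32 / real (card V) \<le> 1" by simp
  have abelian: ?thesis if "\<And>x y. x \<in> H \<Longrightarrow> y \<in> H \<Longrightarrow> x \<otimes> y \<otimes> inv x \<otimes> inv y \<in> N"
  proof -
    have "sd ((G\<lparr>carrier := H\<rparr>) Mod N) = 1"
      by (rule sd_Mod_eq_1[OF gH finH N]) (use that H in \<open>simp add: m_inv_consistent\<close>)
    then show ?thesis using le1 by simp
  qed
  have comm: "x \<otimes> y \<otimes> inv x \<otimes> inv y \<in> H" if "x \<in> H" "y \<in> H" for x y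
    using that H by (simp add: subgroup.m_closed subgroup.m_inv_closed)
  have Hc: "x \<in> carrier G" if "x \<in> H" for x
    using that subgroup.mem_carrier[OF H] by blast
  consider "H \<subseteq> V" | "\<not> H \<subseteq> V" "H \<inter> V = {\<one>}" | "H = carrier G"
    using subgroup_Int_V[OF H] by blast
  then show ?thesis
  proof cases
    case 1
    have "x \<otimes> y \<otimes> inv x \<otimes> inv y = \<one>" if "x \<in> H" "y \<in> H" for x y
    proof -
      have "x \<otimes> y \<otimes> inv x \<otimes> inv y = y \<otimes> x \<otimes> inv x \<otimes> inv y"
        using V_comm[of x y] that 1 by (simp add: subset_iff)
      also have "\<dots> = \<one>"
        using that Hc by (simp add: m_assoc)
      finally show ?thesis .
    qed
    then show ?thesis
      using one by (intro abelian) simp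
  next
    case 2
    have "x \<otimes> y \<otimes> inv x \<otimes> inv y = \<one>" if "x \<in> H" "y \<in> H" for x y
      using 2(2) comm[OF that] commutator_in_V[OF Hc Hc, OF that] by blast
    then show ?thesis
      using one by (intro abelian) simp
  next
    case 3
    then have NG: "N \<lhd> G" using N by simp
    have Nsub: "subgroup N G" using NG by (rule normal_imp_subgroup)
    have "N \<inter> V \<lhd> G"
      by (rule normal_subgroup_intersect[OF NG V_normal])
    then consider "N \<inter> V = {\<one>}" | "V \<subseteq> N"
      using V_minimal[of "N \<inter> V"] by blast
    then show ?thesis
    proof cases
      case 1
      then have "N = {\<one>}" using normal_Int_V_trivial[OF NG] by blast
      then show ?thesis
        using sd_Mod_one[OF is_group] sd_ge 3 by simp
    next
      case 2
      then show ?thesis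
        using commutator_in_V Hc by (intro abelian) blast
    qed
  qed
qed

lemma sd_star_ge: "1 - 32 / real (card V) \<le> sd_star G"
proof -
  define R where "R = {sd ((G\<lparr>carrier := H\<rparr>) Mod N) | H N. subgroup H G \<and> N \<lhd> (G\<lparr>carrier := H\<rparr>)}"
  \<comment> \<open>\<open>Min\<close> is meaningful only for a finite nonempty set. Finiteness
    holds because sections are indexed by pairs of subsets of the carrier; the quotient by
    \<open>V\<close> below witnesses nonemptiness.\<close>
  have "R \<subseteq> (\<lambda>(H, N). sd ((G\<lparr>carrier := H\<rparr>) Mod N)) ` (Pow (carrier G) \<times> Pow (carrier G))"
  proof
    fix r assume "r \<in> R"
    then obtain H N where HN: "subgroup H G" "N \<lhd> (G\<lparr>carrier := H\<rparr>)" "r = sd ((G\<lparr>carrier := H\<rparr>) Mod N)"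
      unfolding R_def by blast
    have "H \<subseteq> carrier G" "N \<subseteq> H"
      using HN subgroup.subset[OF HN(1)] subgroup.subset[OF normal_imp_subgroup[OF HN(2)]] by auto
    then show "r \<in> (\<lambda>(H, N). sd ((G\<lparr>carrier := H\<rparr>) Mod N)) ` (Pow (carrier G) \<times> Pow (carrier G))"
      by (intro image_eqI[of _ _ "(H, N)"]) (auto simp: HN(3))
  qed
  then have "finite R"
    by (rule finite_subset) (simp add: finite_carrier)
  moreover have "sd ((G\<lparr>carrier := carrier G\<rparr>) Mod V) \<in> R"
    unfolding R_def using subgroup_self V_normal
    by (intro CollectI exI[of _ "carrier G"] exI[of _ V]) simp
  ultimately have "Min R \<in> R"
    by (intro Min_in) auto
  then obtain H N where "subgroup H G" "N \<lhd> G\<lparr>carrier := H\<rparr>" "Min R = sd ((G\<lparr>carrier := H\<rparr>) Mod N)"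
    unfolding R_def by blast
  then show ?thesis
    using sd_section_ge[of H N] unfolding sd_star_def R_def[symmetric] by simp
qed

end

section \<open>Irreducible cyclic binary codes\<close>

text \<open>Bit strings of length \<open>q\<close> are coded as natural numbers below
  \<open>2 ^ q\<close>, with XOR as vector addition, so that the final group has type
  \<open>nat monoid\<close>. The Horner sum assembles a number from its binary digits.\<close>

definition rot :: "nat \<Rightarrow> nat \<Rightarrow> nat \<Rightarrow> nat" where
  "rot q i v = horner_sum of_bool 2 (map (\<lambda>n. bit v ((n + i) mod q)) [0..<q])"

lemma bit_rot: "bit (rot q i v) n \<longleftrightarrow> n < q \<and> bit v ((n + i) mod q)"
  by (auto simp: rot_def bit_horner_sum_bit_iff)

lemma rot_xor: "rot q i (v XOR w) = rot q i v XOR rot q i w"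
  by (rule bit_eqI) (auto simp: bit_rot bit_xor_iff)

lemma rot_rot: "rot q i (rot q j v) = rot q (i + j) v"
  by (rule bit_eqI) (auto simp: bit_rot mod_simps ac_simps)

lemma rot_mod: "rot q (i mod q) v = rot q i v"
  by (rule bit_eqI) (auto simp: bit_rot mod_simps)

lemma rot_zero [simp]: "rot q i 0 = 0"
  by (rule bit_eqI) (auto simp: bit_rot)

lemma rot_less: "rot q i v < 2 ^ q"
  unfolding rot_def using horner_sum_of_bool_2_less[of "map (\<lambda>n. bit v ((n + i) mod q)) [0..<q]"]
  by simp

lemma bit_less_power_imp: "bit v n \<Longrightarrow> v < 2 ^ q \<Longrightarrow> n < q" for v :: nat
  by (metis bit_take_bit_iff take_bit_nat_eq_self)

lemma rot_0: "v < 2 ^ q \<Longrightarrow> rot q 0 v = v"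
  by (rule bit_eqI) (use bit_less_power_imp[of v _ q] in \<open>auto simp: bit_rot\<close>)

lemma rot_self: "v < 2 ^ q \<Longrightarrow> rot q q v = v"
  using rot_mod[of q q v] rot_0 by simp

lemma xor_less_power: "v < 2 ^ q \<Longrightarrow> w < 2 ^ q \<Longrightarrow> v XOR w < 2 ^ q" for v w :: nat
  by (metis take_bit_nat_eq_self_iff take_bit_xor)

text \<open>These are the binary cyclic codes of length \<open>q\<close>: subspaces over the field
  with two elements that are invariant under rotation.\<close>

definition cyclic_code :: "nat \<Rightarrow> nat set \<Rightarrow> bool" where
  "cyclic_code q V \<longleftrightarrow> 0 \<in> V \<and> (\<forall>v\<in>V. v < 2 ^ q) \<and> (\<forall>v\<in>V. \<forall>w\<in>V. v XOR w \<in> V) \<and>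
     (\<forall>v\<in>V. \<forall>i. rot q i v \<in> V)"

text \<open>\<open>V\<close> is a simple module for the cyclic group of order \<open>q\<close> over
  the field with two elements, and \<open>no_fixed\<close> excludes the trivial one.\<close>

locale irreducible_code =
  fixes q :: nat and V :: "nat set"
  assumes prime: "Factorial_Ring.prime q"
    and code: "cyclic_code q V"
    and no_fixed: "\<And>v. v \<in> V \<Longrightarrow> rot q 1 v = v \<Longrightarrow> v = 0"
    and nontrivial: "V \<noteq> {0}"
    and irreducible: "\<And>W. cyclic_code q W \<Longrightarrow> W \<subseteq> V \<Longrightarrow> W = {0} \<or> W = V"
begin

lemma q_gt_1: "q > 1"
  using prime prime_gt_1_nat by blast

lemma V_less: "v \<in> V \<Longrightarrow> v < 2 ^ q"
  and V_zero: "0 \<in> V"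
  and V_xor: "v \<in> V \<Longrightarrow> w \<in> V \<Longrightarrow> v XOR w \<in> V"
  and V_rot: "v \<in> V \<Longrightarrow> rot q i v \<in> V"
  using code by (auto simp: cyclic_code_def)

lemma finite_V: "finite V"
  by (rule finite_subset[of _ "{..<2 ^ q}"]) (use V_less in auto)

lemma obtain_nonzero: obtains v where "v \<in> V" "v \<noteq> 0"
  using nontrivial V_zero by blast

text \<open>The stabilizer of \<open>v\<close> is a subgroup of a cyclic group of prime order. If it
  contained the nonzero shift \<open>d\<close>, it would contain the shift by 1, against
  \<open>no_fixed\<close>.\<close>

lemma rot_neq:
  assumes v: "v \<in> V" "v \<noteq> 0" and ij: "i < j" "j < q"
  shows "rot q i v \<noteq> rot q j v"
proof
  assume eq: "rot q i v = rot q j v"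
  define d where "d = j - i"
  \<comment> \<open>A further rotation by \<open>q - i\<close> completes the left side to a full
    turn and makes the right side a rotation by \<open>q + d\<close>.\<close>
  have "rot q (q - i) (rot q i v) = rot q (q - i) (rot q j v)"
    using eq by simp
  moreover have "q - i + j = q + d"
    using ij by (simp add: d_def)
  ultimately have "rot q d v = v"
    using ij rot_mod[of q "q + d" v] rot_mod[of q d v] rot_self[OF V_less[OF v(1)]]
    by (simp add: rot_rot)
  then have power: "rot q (d * k) v = v" for k
    by (induction k) (simp_all add: rot_0 V_less v rot_rot[symmetric])
  \<comment> \<open>Since \<open>0 < d < q\<close> and \<open>q\<close> is prime, \<open>d\<close>
    has an inverse \<open>k\<close> modulo \<open>q\<close>; repeating the shift \<open>d\<close>
    then gives the shift by 1.\<close>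
  have "coprime d q"
    using prime ij by (intro prime_imp_coprime_nat[THEN coprime_imp_coprime, of q d])
      (auto simp: d_def dest: dvd_imp_le)
  then obtain k where "[d * k = 1] (mod q)"
    using cong_solve_coprime_nat by auto
  then have "rot q 1 v = v"
    using power[of k] rot_mod[of q "d * k" v] rot_mod[of q 1 v] by (simp add: cong_def)
  then show False
    using no_fixed v by blast
qed

text \<open>The orbit of a nonzero vector under rotation has \<open>q\<close> distinct
  elements.\<close>

lemma card_V_ge: "q \<le> card V"
proof -
  obtain v where v: "v \<in> V" "v \<noteq> 0"
    by (rule obtain_nonzero)
  have "inj_on (\<lambda>i. rot q i v) {..<q}"
    by (rule inj_onI) (metis rot_neq[OF v] lessThan_iff linorder_neqE_nat)
  from card_inj_on_le[OF this _ finite_V] show ?thesis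
    using V_rot[OF v(1)] by auto
qed

text \<open>The semidirect product of \<open>V\<close> with the cyclic group of rotations; the pair \<open>(v, i)\<close> is coded as \<open>v * q + i\<close>.\<close>

definition rot_group :: "nat monoid" where
  "rot_group = \<lparr>carrier = {x. x div q \<in> V},
     monoid.mult = (\<lambda>x y. (x div q XOR rot q (x mod q) (y div q)) * q + (x + y) mod q), one = 0\<rparr>"

lemma carrier_rot_group: "x \<in> carrier rot_group \<longleftrightarrow> x div q \<in> V"
  by (simp add: rot_group_def)

lemma one_rot_group: "\<one>\<^bsub>rot_group\<^esub> = 0"
  by (simp add: rot_group_def)

lemma div_mult_rot_group:
  "(x \<otimes>\<^bsub>rot_group\<^esub> y) div q = x div q XOR rot q x (y div q)"
  using q_gt_1 by (simp add: rot_group_def rot_mod)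

lemma mod_mult_rot_group: "(x \<otimes>\<^bsub>rot_group\<^esub> y) mod q = (x + y) mod q"
  by (simp add: rot_group_def)

lemma eq_if_div_mod_eq: "x div q = y div q \<Longrightarrow> x mod q = y mod q \<Longrightarrow> x = y" for x y :: nat
  by (metis div_mult_mod_eq)

lemma rot_cong: "i mod q = j mod q \<Longrightarrow> rot q i v = rot q j v"
  by (metis rot_mod)

lemma group_rot_group: "group rot_group"
proof (rule groupI)
  show "\<one>\<^bsub>rot_group\<^esub> \<in> carrier rot_group"
    by (simp add: carrier_rot_group one_rot_group V_zero)
  fix x y assume x: "x \<in> carrier rot_group" and y: "y \<in> carrier rot_group"
  then show "x \<otimes>\<^bsub>rot_group\<^esub> y \<in> carrier rot_group"
    by (simp add: carrier_rot_group div_mult_rot_group V_xor V_rot)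
  show "x \<otimes>\<^bsub>rot_group\<^esub> y \<otimes>\<^bsub>rot_group\<^esub> z = x \<otimes>\<^bsub>rot_group\<^esub> (y \<otimes>\<^bsub>rot_group\<^esub> z)" for z
  proof (rule eq_if_div_mod_eq)
    have "rot q (x \<otimes>\<^bsub>rot_group\<^esub> y) w = rot q (x + y) w" for w
      by (rule rot_cong) (simp add: mod_mult_rot_group)
    then show "(x \<otimes>\<^bsub>rot_group\<^esub> y \<otimes>\<^bsub>rot_group\<^esub> z) div q = (x \<otimes>\<^bsub>rot_group\<^esub> (y \<otimes>\<^bsub>rot_group\<^esub> z)) div q"
      by (simp add: div_mult_rot_group rot_xor rot_rot xor.assoc)
    show "(x \<otimes>\<^bsub>rot_group\<^esub> y \<otimes>\<^bsub>rot_group\<^esub> z) mod q = (x \<otimes>\<^bsub>rot_group\<^esub> (y \<otimes>\<^bsub>rot_group\<^esub> z)) mod q"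
      using mod_add_cong[OF mod_mult_rot_group refl] mod_add_cong[OF refl mod_mult_rot_group]
      by (simp add: mod_mult_rot_group add.assoc)
  qed
  show "\<one>\<^bsub>rot_group\<^esub> \<otimes>\<^bsub>rot_group\<^esub> x = x"
    by (rule eq_if_div_mod_eq)
      (use x in \<open>simp_all add: div_mult_rot_group mod_mult_rot_group one_rot_group carrier_rot_group rot_0 V_less\<close>)
  define j where "j = q - x mod q"
  have j: "j + x mod q = q"
    using q_gt_1 by (simp add: j_def)
  define i where "i = rot q j (x div q) * q + j mod q"
  have i: "i div q = rot q j (x div q)" "i mod q = j mod q"
    using q_gt_1 by (simp_all add: i_def)
  have "(j + x) mod q = 0"
    using j by (metis mod_add_right_eq mod_self)
  then have "(i + x) mod q = 0"
    using mod_add_cong[OF i(2) refl, of x] by simp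
  moreover have "i \<in> carrier rot_group"
    using x by (simp add: i carrier_rot_group V_rot)
  moreover have "rot q i (x div q) = rot q j (x div q)"
    by (rule rot_cong[OF i(2)])
  ultimately show "\<exists>y\<in>carrier rot_group. y \<otimes>\<^bsub>rot_group\<^esub> x = \<one>\<^bsub>rot_group\<^esub>"
    by (intro bexI[of _ i], rule_tac eq_if_div_mod_eq)
      (simp_all add: div_mult_rot_group mod_mult_rot_group one_rot_group i)
qed

sublocale rot_group: group rot_group
  by (rule group_rot_group)

section \<open>The copy of \<open>V\<close> inside the semidirect product\<close>

definition base :: "nat set" where
  "base = (\<lambda>v. v * q) ` V"

text \<open>\<open>base\<close> is the kernel of reduction modulo \<open>q\<close>, a homomorphism
  to the integers modulo \<open>q\<close> by \<open>mod_mult_rot_group\<close>. Membership thus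
  becomes a divisibility question.\<close>

lemma base_iff: "x \<in> base \<longleftrightarrow> x \<in> carrier rot_group \<and> q dvd x"
  using q_gt_1 by (auto simp: base_def carrier_rot_group dvd_def image_iff mult.commute)

lemma card_base: "card base = card V"
  unfolding base_def by (rule card_image) (use q_gt_1 in \<open>auto simp: inj_on_def\<close>)

lemma base_mult: "v \<in> V \<Longrightarrow> w \<in> V \<Longrightarrow> (v * q) \<otimes>\<^bsub>rot_group\<^esub> (w * q) = (v XOR w) * q"
  using q_gt_1 by (simp add: rot_group_def rot_0 V_less)

text \<open>The residue of an inverse is the negative residue, phrased as a sum to avoid subtraction
  on naturals.\<close>

lemma q_dvd_inv_add:
  assumes "x \<in> carrier rot_group"
  shows "q dvd inv\<^bsub>rot_group\<^esub> x + x"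
  using mod_mult_rot_group[of "inv\<^bsub>rot_group\<^esub> x" x] rot_group.l_inv[OF assms]
  by (simp add: one_rot_group mod_eq_0_iff_dvd[symmetric])

lemma q_dvd_mult_iff: "q dvd x \<otimes>\<^bsub>rot_group\<^esub> y \<longleftrightarrow> q dvd x + y"
  by (metis mod_mult_rot_group dvd_eq_mod_eq_0)

lemma subgroup_base: "subgroup base rot_group"
proof (rule rot_group.subgroupI)
  show "base \<subseteq> carrier rot_group" "base \<noteq> {}"
    using V_zero by (auto simp: base_iff) (auto simp: base_def)
  show "inv\<^bsub>rot_group\<^esub> x \<in> base" if "x \<in> base" for x
    using that q_dvd_inv_add[of x] by (auto simp: base_iff dvd_add_left_iff)
  show "x \<otimes>\<^bsub>rot_group\<^esub> y \<in> base" if "x \<in> base" "y \<in> base" for x y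
    using that by (auto simp: base_iff q_dvd_mult_iff)
qed

text \<open>The quotient by \<open>base\<close> has prime order. An element \<open>x\<close> of
  \<open>H\<close> outside \<open>base\<close> has a residue coprime to \<open>q\<close>, so its
  powers reach every residue, and elements with equal residues differ by an element of
  \<open>base\<close>.\<close>

lemma base_maximal:
  assumes H: "subgroup H rot_group" and "base \<subseteq> H"
  shows "H = base \<or> H = carrier rot_group"
proof (cases "H \<subseteq> base")
  case False
  note Hc = subgroup.mem_carrier[OF H]
  obtain x where x: "x \<in> H" "\<not> q dvd x"
    using False Hc by (metis base_iff subsetI)
  have pow: "(x [^]\<^bsub>rot_group\<^esub> k) mod q = (x * k) mod q" for k :: nat
  proof (induction k)
    case (Suc k)
    then show ?case
      using mod_add_cong[OF Suc refl, of x] by (simp add: mod_mult_rot_group add.commute)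
  qed (simp add: one_rot_group)
  have "coprime x q"
    using prime x(2) by (simp add: prime_imp_coprime_nat coprime_commute)
  then obtain k where k: "[x * k = 1] (mod q)"
    using cong_solve_coprime_nat by auto
  have "y \<in> H" if y: "y \<in> carrier rot_group" for y
  proof -
    \<comment> \<open>As \<open>k\<close> inverts \<open>x\<close> modulo \<open>q\<close>, this
      power has the residue of \<open>y\<close>.\<close>
    define z where "z = x [^]\<^bsub>rot_group\<^esub> (k * y)"
    have zH: "z \<in> H"
      unfolding z_def using H x(1) by (metis rot_group.subgroup_int_pow_closed int_pow_int)
    have zc: "z \<in> carrier rot_group"
      using zH Hc by blast
    have "[x * k * y = 1 * y] (mod q)"
      by (rule cong_scalar_right[OF k])
    then have "z mod q = y mod q"
      by (simp add: z_def pow cong_def mult.assoc)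
    then have "(inv\<^bsub>rot_group\<^esub> z + y) mod q = (inv\<^bsub>rot_group\<^esub> z + z) mod q"
      by (intro mod_add_cong) simp_all
    then have "q dvd inv\<^bsub>rot_group\<^esub> z + y"
      using q_dvd_inv_add[OF zc] by (simp add: dvd_eq_mod_eq_0)
    then have "inv\<^bsub>rot_group\<^esub> z \<otimes>\<^bsub>rot_group\<^esub> y \<in> H"
      using assms(2) zc y by (auto simp: base_iff q_dvd_mult_iff)
    then have "z \<otimes>\<^bsub>rot_group\<^esub> (inv\<^bsub>rot_group\<^esub> z \<otimes>\<^bsub>rot_group\<^esub> y) \<in> H"
      using zH subgroup.m_closed[OF H] by blast
    then show ?thesis
      using zc y by (simp add: rot_group.m_assoc[symmetric])
  qed
  then show ?thesis
    using Hc by blast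
qed (use assms in blast)

text \<open>Conjugation by a rotation acts on \<open>V\<close> as that rotation, so a normal
  subgroup inside \<open>base\<close> corresponds to a cyclic code \<open>U\<close> inside
  \<open>V\<close>, and irreducibility applies.\<close>

lemma base_minimal:
  assumes W: "W \<lhd> rot_group" "W \<subseteq> base"
  shows "W = {\<one>\<^bsub>rot_group\<^esub>} \<or> W = base"
proof -
  define U where "U = {v. v * q \<in> W}"
  have WU: "W = (\<lambda>v. v * q) ` U"
    using W(2) by (auto simp: U_def base_def)
  have UV: "U \<subseteq> V"
    using W(2) q_gt_1 by (auto simp: U_def base_def)
  have sub: "subgroup W rot_group"
    by (rule normal_imp_subgroup[OF W(1)])
  have "cyclic_code q U"
    unfolding cyclic_code_def
  proof (intro conjI ballI allI)
    show "0 \<in> U"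
      using subgroup.one_closed[OF sub] by (simp add: U_def one_rot_group)
    fix v assume v: "v \<in> U"
    then show "v < 2 ^ q" using UV V_less by blast
    show "v XOR w \<in> U" if "w \<in> U" for w
    proof -
      have "v \<in> V" "w \<in> V"
        using that v UV by blast+
      then show ?thesis
        using that v subgroup.m_closed[OF sub, of "v * q" "w * q"] by (simp add: U_def base_mult)
    qed
    fix i
    define j where "j = i mod q"
    have vV: "v \<in> V" using v UV by blast
    have jc: "j \<in> carrier rot_group" and rc: "rot q i v * q \<in> carrier rot_group"
      using q_gt_1 V_zero V_rot[OF vV] by (simp_all add: carrier_rot_group j_def)
    \<comment> \<open>Being smaller than \<open>q\<close>, the number \<open>j\<close> codes the
      pure rotation with zero vector.\<close>
    have "j \<otimes>\<^bsub>rot_group\<^esub> (v * q) = (rot q i v * q) \<otimes>\<^bsub>rot_group\<^esub> j"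
      using q_gt_1 by (simp add: rot_group_def j_def rot_mod)
    then have "j \<otimes>\<^bsub>rot_group\<^esub> (v * q) \<otimes>\<^bsub>rot_group\<^esub> inv\<^bsub>rot_group\<^esub> j = rot q i v * q"
      using jc rc by (simp add: rot_group.m_assoc)
    moreover have "j \<otimes>\<^bsub>rot_group\<^esub> (v * q) \<otimes>\<^bsub>rot_group\<^esub> inv\<^bsub>rot_group\<^esub> j \<in> W"
      using W(1) jc v by (simp add: rot_group.normal_inv_iff U_def)
    ultimately show "rot q i v \<in> U"
      by (simp add: U_def)
  qed
  then have "U = {0} \<or> U = V"
    using irreducible UV by blast
  then show ?thesis
    using WU by (auto simp: one_rot_group base_def)
qed

lemma minimal_nonnilpotent_rot_group: "minimal_nonnilpotent rot_group base"
proof (intro minimal_nonnilpotent.intro minimal_nonnilpotent_axioms.intro group_rot_group)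
  have "carrier rot_group \<subseteq> (\<lambda>(v, i). v * q + i) ` (V \<times> {..<q})"
  proof
    fix x assume "x \<in> carrier rot_group"
    then show "x \<in> (\<lambda>(v, i). v * q + i) ` (V \<times> {..<q})"
      using q_gt_1 by (intro image_eqI[of _ _ "(x div q, x mod q)"]) (auto simp: carrier_rot_group)
  qed
  then show "finite (carrier rot_group)"
    by (rule finite_subset) (use finite_V in auto)
  show "subgroup base rot_group"
    by (rule subgroup_base)
  show "x \<otimes>\<^bsub>rot_group\<^esub> y = y \<otimes>\<^bsub>rot_group\<^esub> x" if "x \<in> base" "y \<in> base" for x y
    using that by (auto simp: base_def base_mult xor.commute)
  show "x \<otimes>\<^bsub>rot_group\<^esub> x = \<one>\<^bsub>rot_group\<^esub>" if "x \<in> base" for x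
    using that by (auto simp: base_def base_mult one_rot_group)
  show "x \<otimes>\<^bsub>rot_group\<^esub> y \<otimes>\<^bsub>rot_group\<^esub> inv\<^bsub>rot_group\<^esub> x \<otimes>\<^bsub>rot_group\<^esub> inv\<^bsub>rot_group\<^esub> y \<in> base"
    if xy: "x \<in> carrier rot_group" "y \<in> carrier rot_group" for x y
  proof -
    \<comment> \<open>Modulo \<open>q\<close> the product becomes a sum, in which the terms of the
      commutator cancel.\<close>
    have "(x \<otimes>\<^bsub>rot_group\<^esub> y \<otimes>\<^bsub>rot_group\<^esub> inv\<^bsub>rot_group\<^esub> x \<otimes>\<^bsub>rot_group\<^esub> inv\<^bsub>rot_group\<^esub> y) mod q
        = (x + y + inv\<^bsub>rot_group\<^esub> x + inv\<^bsub>rot_group\<^esub> y) mod q"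
      using mod_mult_rot_group by (metis mod_add_left_eq)
    also have "q dvd x + y + inv\<^bsub>rot_group\<^esub> x + inv\<^bsub>rot_group\<^esub> y"
      using dvd_add[OF q_dvd_inv_add[OF xy(1)] q_dvd_inv_add[OF xy(2)]] by (simp add: ac_simps)
    then have "(x + y + inv\<^bsub>rot_group\<^esub> x + inv\<^bsub>rot_group\<^esub> y) mod q = 0"
      by simp
    finally show ?thesis
      using xy by (simp add: base_iff dvd_eq_mod_eq_0)
  qed
  show "H = base \<or> H = carrier rot_group" if "subgroup H rot_group" "base \<subseteq> H" for H
    using base_maximal that .
  show "W = {\<one>\<^bsub>rot_group\<^esub>} \<or> W = base" if "W \<lhd> rot_group" "W \<subseteq> base" for W
    using base_minimal that .
  obtain v where v: "v \<in> V" "v \<noteq> 0"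
    by (rule obtain_nonzero)
  \<comment> \<open>The number 1 codes the rotation by one place; comparing vector components of the
    two products gives \<open>v\<close> against its rotation.\<close>
  have "(v * q) \<otimes>\<^bsub>rot_group\<^esub> 1 \<noteq> 1 \<otimes>\<^bsub>rot_group\<^esub> (v * q)"
  proof
    assume "(v * q) \<otimes>\<^bsub>rot_group\<^esub> 1 = 1 \<otimes>\<^bsub>rot_group\<^esub> (v * q)"
    from arg_cong[OF this, of "\<lambda>x. x div q"] have "rot q 1 v = v"
      using q_gt_1 by (simp add: div_mult_rot_group)
    then show False
      using no_fixed v by blast
  qed
  then show "\<exists>v\<in>base. \<exists>g\<in>carrier rot_group. v \<otimes>\<^bsub>rot_group\<^esub> g \<noteq> g \<otimes>\<^bsub>rot_group\<^esub> v"
    using v q_gt_1 V_zero by (intro bexI[of _ "v * q"] bexI[of _ 1]) (auto simp: base_def carrier_rot_group)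
qed

end

section \<open>Existence of an irreducible code without fixed vectors\<close>

text \<open>The image \<open>U\<close> of the map adding a vector to its rotation is a nonzero
  cyclic code, and for odd \<open>q\<close> it has no nonzero fixed vector. Subcodes inherit the
  latter property, so a code of least size with property \<open>P\<close> is irreducible.\<close>

lemma irreducible_code_exists:
  assumes "Factorial_Ring.prime q" "odd q"
  obtains V where "irreducible_code q V"
proof -
  have q: "q > 1"
    using assms(1) prime_gt_1_nat by blast
  define P where "P = (\<lambda>V. cyclic_code q V \<and> (\<forall>v\<in>V. rot q 1 v = v \<longrightarrow> v = 0) \<and> V \<noteq> {0})"
  define U where "U = (\<lambda>v. rot q 1 v XOR v) ` {..<2 ^ q}"
  have "P U"
    unfolding P_def
  proof (intro conjI ballI impI)
    show "cyclic_code q U"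
      unfolding cyclic_code_def
    proof (intro conjI ballI allI)
      show "0 \<in> U"
        by (auto simp: U_def intro!: image_eqI[of _ _ 0])
      fix u assume "u \<in> U"
      then obtain v where v: "v < 2 ^ q" "u = rot q 1 v XOR v"
        by (auto simp: U_def)
      show "u < 2 ^ q"
        using v by (simp add: xor_less_power rot_less)
      show "rot q i u \<in> U" for i
        unfolding U_def
        by (rule image_eqI[of _ _ "rot q i v"]) (simp_all add: v rot_less rot_xor rot_rot add.commute)
      fix u' assume "u' \<in> U"
      then obtain v' where v': "v' < 2 ^ q" "u' = rot q 1 v' XOR v'"
        by (auto simp: U_def)
      show "u XOR u' \<in> U"
        unfolding U_def
        by (rule image_eqI[of _ _ "v XOR v'"]) (simp_all add: v v' rot_xor xor_less_power xor.assoc xor.left_commute)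
    qed
    \<comment> \<open>The string with only bit 0 set is rotated to the one with only bit
      \<open>q - 1\<close> set, so their sum is nonzero.\<close>
    have "bit (rot q 1 1 XOR 1) 0"
      using q by (simp add: bit_xor_iff bit_rot bit_1_iff del: One_nat_def)
    then have "rot q 1 1 XOR 1 \<noteq> 0"
      by (intro notI) (simp del: One_nat_def)
    moreover have "rot q 1 1 XOR 1 \<in> U"
      using q unfolding U_def by (intro image_eqI[OF refl]) (simp add: one_less_power del: One_nat_def)
    ultimately show "U \<noteq> {0}"
      by blast
    fix u assume "u \<in> U" and fixed: "rot q 1 u = u"
    then obtain v where v: "v < 2 ^ q" "u = rot q 1 v XOR v"
      by (auto simp: U_def)
    \<comment> \<open>A fixed string is constant, so only the all-ones string has to be
      excluded.\<close>
    have u0: "bit u n = bit u 0" if "n < q" for n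
      using that
    proof (induction n)
      case (Suc n)
      then show ?case
        using arg_cong[OF fixed, of "\<lambda>u. bit u n"] by (simp add: bit_rot)
    qed simp
    have step: "bit u n = (bit v (Suc n mod q) \<noteq> bit v n)" if "n < q" for n
      using that by (simp add: v bit_xor_iff bit_rot)
    have "\<not> bit u 0"
    proof
      assume "bit u 0"
      \<comment> \<open>If \<open>u\<close> were all ones, the bits of \<open>v\<close> would
        alternate around a cycle of odd length \<open>q\<close>; the wrap-around at position
        \<open>q - 1\<close> gives the contradiction.\<close>
      then have alt: "bit v (Suc n mod q) = (\<not> bit v n)" if "n < q" for n
        using u0[OF that] step[OF that] by auto
      have "bit v n = (bit v 0 \<noteq> odd n)" if "n < q" for n
        using that
      proof (induction n)
        case (Suc n)
        then show ?case using alt[of n] by auto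
      qed simp
      from this[of "q - 1"] alt[of "q - 1"] show False
        using q assms(2) by auto
    qed
    moreover have "u < 2 ^ q"
      using v by (simp add: xor_less_power rot_less)
    ultimately have "\<not> bit u n" for n
      using u0[of n] bit_less_power_imp[of u n q] by blast
    then show "u = 0"
      by (intro bit_eqI) simp
  qed
  then obtain V where V: "P V" "\<And>W. P W \<Longrightarrow> card V \<le> card W"
    using ex_has_least_nat[of P U card] by blast
  have "irreducible_code q V"
  proof
    show "Factorial_Ring.prime q" by fact
    show "cyclic_code q V" "V \<noteq> {0}" "\<And>v. v \<in> V \<Longrightarrow> rot q 1 v = v \<Longrightarrow> v = 0"
      using V(1) by (auto simp: P_def)
    fix W assume W: "cyclic_code q W" "W \<subseteq> V"
    show "W = {0} \<or> W = V"
    proof (rule ccontr)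
      assume *: "\<not> ?thesis"
      then have "P W"
        using V(1) W by (auto simp: P_def)
      then have "card V \<le> card W"
        by (rule V(2))
      moreover have "finite V"
        by (rule finite_subset[of _ "{..<2 ^ q}"]) (use V(1) in \<open>auto simp: P_def cyclic_code_def\<close>)
      ultimately show False
        using * W(2) card_seteq by blast
    qed
  qed
  then show ?thesis
    by (rule that)
qed

section \<open>Refuting any constant with a large prime\<close>

theorem theorem3:
  shows "\<not> (\<exists>c::real. 0 < c \<and> c < 1 \<and>
            (\<forall>G :: nat monoid. group G \<longrightarrow> finite (carrier G) \<longrightarrow>
                 sd_star G > c \<longrightarrow> Iwasawa_group G))"
proof
  assume "\<exists>c::real. 0 < c \<and> c < 1 \<and>
            (\<forall>G :: nat monoid. group G \<longrightarrow> finite (carrier G) \<longrightarrow>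
                 sd_star G > c \<longrightarrow> Iwasawa_group G)"
  then obtain c :: real where c: "c < 1"
    and all: "\<And>G :: nat monoid. group G \<Longrightarrow> finite (carrier G) \<Longrightarrow> sd_star G > c \<Longrightarrow> Iwasawa_group G"
    by blast
  \<comment> \<open>This \<open>n\<close> is chosen so that a normal subgroup of order at least
    \<open>n\<close> makes \<open>1 - 32 / real (card base)\<close> exceed \<open>c\<close>. The
    bound 2 in the choice of \<open>q\<close> ensures that the prime is odd.\<close>
  obtain n :: nat where n: "32 / (1 - c) < real n"
    using reals_Archimedean2 by blast
  obtain q :: nat where q: "Factorial_Ring.prime q" "max n 2 < q"
    using bigger_prime by blast
  then have "odd q"
    using prime_odd_nat by auto
  then obtain V where "irreducible_code q V"
    using irreducible_code_exists q(1) by blast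
  then interpret irreducible_code q V .
  interpret minimal_nonnilpotent rot_group base
    by (rule minimal_nonnilpotent_rot_group)
  have "32 / (1 - c) < real (card base)"
    using n q(2) card_V_ge by (simp add: card_base)
  moreover have "real (card base) > 0"
    using q(2) card_V_ge by (simp add: card_base)
  ultimately have "c < 1 - 32 / real (card base)"
    using c by (simp add: field_simps)
  then have "c < sd_star rot_group"
    using sd_star_ge by linarith
  then have "Iwasawa_group rot_group"
    using all group_rot_group finite_carrier by blast
  then show False
    using not_nilpotent by (simp add: Iwasawa_group_def)
qed

end
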